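(* Let $Y$ be a Hilbert space and $\phi(x,y)=\|Kx-y\|^2$, and suppose that the exact solution $x^\dagger$ satisfies the source condition $$\mathrm{range}(K^* )\cap\partial\psi_1(x^\dagger)\cap\partial\psi_2(x^\dagger)\neq\emptyset .$$ Let $c_m\ge1$ be fixed. Then there is a constant $C$ such that for every $\delta>0$, every $y^\delta\in Y$ with $\|Kx^\dagger-y^\delta\|^2=\delta^2$, every $\boldsymbol\eta^*=(\eta_1^*,\eta_2^* )$ with $\eta_1^*,\eta_2^*>0$ and every minimizer $x^\delta_{\boldsymbol\eta^*}$ over $Q_{\mathrm{ad}}$ of $J_{\boldsymbol\eta^*}(x)=\|Kx-y^\delta\|^2+\eta_1^*\psi_1(x)+\eta_2^*\psi_2(x)$ satisfying the discrepancy equation $$\|Kx^\delta_{\boldsymbol\eta^*}-y^\delta\|^2=c_m\delta^2,$$ there exist some $i\in\{1,2\}$ and some $\xi_i\in\partial\psi_i(x^\dagger)$ such that $$d_{\xi_i}(x^\delta_{\boldsymbol\eta^*},x^\dagger)\le C\delta ,$$ where $d_{\xi_i}$ is the Bregman distance associated with $\psi_i$.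
   Context: Setting: $X$ is a Banach space with dual $X^*$, $K:X\to Y$ is bounded and linear, $K^*:Y\to X^*$ is its adjoint (with $Y$ identified with its dual), and $Q_{\mathrm{ad}}\subset X$ is a convex constraint set. The penalties $\psi_1,\psi_2:X\to[0,\infty]$ are convex and (weakly) lower semicontinuous. The exact solution $x^\dagger\in Q_{\mathrm{ad}}$ satisfies $\psi_i(x^\dagger)<\infty$ for $i=1,2$. For a functional $\psi$, $\partial\psi(x^\dagger)=\{\xi\in X^*:\psi(x)\ge\psi(x^\dagger)+\langle\xi,x-x^\dagger\rangle\ \forall x\in X\}$, and for $\xi\in\partial\psi(x^\dagger)$ the Bregman distance is $d_\xi(x,x^\dagger)=\psi(x)-\psi(x^\dagger)-\langle\xi,x-x^\dagger\rangle$. *)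

theory Defs
  imports "HOL-Analysis.Analysis"
begin

text \<open>
  The dual \<open>X\<^sup>*\<close> of a real normed space \<open>'a\<close> is the type \<open>'a \<Rightarrow>\<^sub>L real\<close> of bounded linear
  functionals. Extended-valued functionals are \<open>ereal\<close>-valued, because subgradient inequalities
  involve negative numbers; nonnegativity is a separate hypothesis where it is needed.
\<close>

text \<open>
  The adjoint \<open>K\<^sup>* : Y \<rightarrow> X\<^sup>*\<close>, where \<open>Y\<close> is identified with its dual through the inner
  product (the library constant \<open>adjoint\<close> needs inner products on both sides).
\<close>

definition banach_adjoint ::
  "('a::real_normed_vector \<Rightarrow>\<^sub>L 'b::real_inner) \<Rightarrow> 'b \<Rightarrow> ('a \<Rightarrow>\<^sub>L real)"
  where "banach_adjoint K y = blinfun_inner_right y o\<^sub>L K"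

lemma banach_adjoint_apply [simp]:
  "blinfun_apply (banach_adjoint K y) x = inner y (blinfun_apply K x)"
  by (simp add: banach_adjoint_def)

text \<open>
  Convexity with the convention \<open>0 * \<infinity> = 0\<close> of \<open>ereal\<close>. It is meant for functionals that do not
  take the value \<open>-\<infinity>\<close>, so that no sum \<open>\<infinity> + (-\<infinity>)\<close> arises on the right-hand side.
\<close>

definition convex_functional :: "('a::real_vector \<Rightarrow> ereal) \<Rightarrow> bool"
  where "convex_functional \<psi> \<longleftrightarrow>
    (\<forall>x y t. 0 \<le> t \<and> t \<le> 1 \<longrightarrow>
      \<psi> ((1 - t) *\<^sub>R x + t *\<^sub>R y) \<le> ereal (1 - t) * \<psi> x + ereal t * \<psi> y)"

text \<open>
  Lower semicontinuity for the norm topology. It is implied by weak (and by weak sequential) lower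
  semicontinuity, and for convex functionals it is equivalent to them by Mazur's theorem.
\<close>

definition lower_semicontinuous :: "('a::topological_space \<Rightarrow> ereal) \<Rightarrow> bool"
  where "lower_semicontinuous \<psi> \<longleftrightarrow> (\<forall>x. \<psi> x \<le> Liminf (at x) \<psi>)"

definition subdifferential ::
  "('a::real_normed_vector \<Rightarrow> ereal) \<Rightarrow> 'a \<Rightarrow> ('a \<Rightarrow>\<^sub>L real) set"
  where "subdifferential \<psi> x0 =
    {\<xi>. \<forall>x. \<psi> x \<ge> \<psi> x0 + ereal (blinfun_apply \<xi> (x - x0))}"

text \<open>Only used for base points \<open>x0\<close> with \<open>\<psi> x0\<close> finite; the value is \<open>\<infinity>\<close> if \<open>\<psi> x = \<infinity>\<close>.\<close>

definition bregman_distance ::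
  "('a::real_normed_vector \<Rightarrow> ereal) \<Rightarrow> ('a \<Rightarrow>\<^sub>L real) \<Rightarrow> 'a \<Rightarrow> 'a \<Rightarrow> ereal"
  where "bregman_distance \<psi> \<xi> x x0 = \<psi> x - \<psi> x0 - ereal (blinfun_apply \<xi> (x - x0))"

definition fidelity ::
  "('a::real_normed_vector \<Rightarrow>\<^sub>L 'b::real_normed_vector) \<Rightarrow> 'a \<Rightarrow> 'b \<Rightarrow> real"
  where "fidelity K x y = (norm (blinfun_apply K x - y))\<^sup>2"

definition tikhonov_functional ::
  "('a::real_normed_vector \<Rightarrow>\<^sub>L 'b::real_normed_vector) \<Rightarrow> ('a \<Rightarrow> ereal) \<Rightarrow> ('a \<Rightarrow> ereal) \<Rightarrow>
    real \<times> real \<Rightarrow> 'b \<Rightarrow> 'a \<Rightarrow> ereal"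
  where "tikhonov_functional K \<psi>1 \<psi>2 \<eta> y x =
    ereal (fidelity K x y) + ereal (fst \<eta>) * \<psi>1 x + ereal (snd \<eta>) * \<psi>2 x"

definition minimizer_over :: "'a set \<Rightarrow> ('a \<Rightarrow> ereal) \<Rightarrow> 'a \<Rightarrow> bool"
  where "minimizer_over Q J x \<longleftrightarrow> x \<in> Q \<and> (\<forall>z\<in>Q. J x \<le> J z)"

end

theory Submission
  imports Defs
begin

text \<open>
  A minimizer whose residual is at least that of the exact solution cannot have both penalties
  larger than the exact solution has: its Tikhonov functional would be strictly larger. The
  discrepancy equation with \<open>cm \<ge> 1\<close> provides the comparison of the residuals, so at least one
  penalty \<open>\<psi>\<close> does not increase (\<open>penalty_decreases_at_minimizer\<close>). For this penalty the Bregman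
  distance is at most \<open>- \<langle>\<xi>, x - xdag\<rangle>\<close>. The source condition supplies one element \<open>\<xi> = K\<^sup>* w\<close>
  that is a subgradient of both penalties, which turns this term into \<open>\<langle>w, K xdag - K x\<rangle>\<close>; the
  two residuals, \<open>sqrt cm * \<delta>\<close> and \<open>\<delta>\<close>, bound it (\<open>bregman_distance_le_residuals\<close>). The
  resulting constant \<open>norm w * (sqrt cm + 1)\<close> depends neither on the data nor on the
  regularization parameters, nor on which of the penalties is the one that does not increase.
\<close>

text \<open>
  If both penalties were larger at \<open>x\<close> than at \<open>x0\<close>, then \<open>x0\<close> would be a strictly better
  competitor, because its residual is no larger and the weights are positive.
\<close>

lemma penalty_decreases_at_minimizer:
  fixes K :: "'a::real_normed_vector \<Rightarrow>\<^sub>L 'b::real_normed_vector"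
  assumes min: "minimizer_over Q (tikhonov_functional K \<psi>1 \<psi>2 (\<eta>1, \<eta>2) y) x"
    and "x0 \<in> Q" and fid: "fidelity K x0 y \<le> fidelity K x y"
    and pos: "0 < \<eta>1" "0 < \<eta>2"
    and fin: "\<bar>\<psi>1 x0\<bar> \<noteq> \<infinity>" "\<bar>\<psi>2 x0\<bar> \<noteq> \<infinity>"
  shows "\<psi>1 x \<le> \<psi>1 x0 \<or> \<psi>2 x \<le> \<psi>2 x0"
proof (rule ccontr)
  assume "\<not> ?thesis"
  then have gt: "\<psi>1 x0 < \<psi>1 x" "\<psi>2 x0 < \<psi>2 x"
    by auto
  obtain a b where ab: "\<psi>1 x0 = ereal a" "\<psi>2 x0 = ereal b"
    using fin by auto
  have "tikhonov_functional K \<psi>1 \<psi>2 (\<eta>1, \<eta>2) y x0 < tikhonov_functional K \<psi>1 \<psi>2 (\<eta>1, \<eta>2) y x"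
  proof (cases "\<psi>1 x = \<infinity> \<or> \<psi>2 x = \<infinity>")
    case True
    then show ?thesis
      using gt ab pos by (cases "\<psi>1 x"; cases "\<psi>2 x") (auto simp: tikhonov_functional_def)
  next
    case False
    then obtain c d where cd: "\<psi>1 x = ereal c" "\<psi>2 x = ereal d"
      using gt ab by (cases "\<psi>1 x"; cases "\<psi>2 x") auto
    have "\<eta>1 * a < \<eta>1 * c" "\<eta>2 * b < \<eta>2 * d"
      using gt pos ab cd by auto
    then show ?thesis
      using fid ab cd by (simp add: tikhonov_functional_def)
  qed
  then show False
    using min \<open>x0 \<in> Q\<close> by (auto simp: minimizer_over_def not_le)
qed

text \<open>
  Where the penalty does not increase, only the linear term of the Bregman distance can be
  positive. A subgradient in the range of the adjoint sees \<open>x - x0\<close> only through \<open>K\<close>, hence the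
  residuals of \<open>x\<close> and \<open>x0\<close> with respect to any common data \<open>y\<close> control this term.
\<close>

lemma bregman_distance_le_residuals:
  fixes K :: "'a::real_normed_vector \<Rightarrow>\<^sub>L 'b::real_inner"
  assumes le: "\<psi> x \<le> \<psi> x0" and fin: "\<bar>\<psi> x0\<bar> \<noteq> \<infinity>"
  shows "bregman_distance \<psi> (banach_adjoint K w) x x0
    \<le> ereal (norm w * (norm (K x - y) + norm (K x0 - y)))"
proof -
  have "- inner w (K (x - x0)) \<le> norm w * norm (K (x - x0))"
    using Cauchy_Schwarz_ineq2[of w "K (x - x0)"] by linarith
  also have "norm (K (x - x0)) \<le> norm (K x - y) + norm (K x0 - y)"
    using norm_triangle_ineq4[of "K x - y" "K x0 - y"] by (simp add: blinfun.diff_right)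
  finally have "- inner w (K (x - x0)) \<le> norm w * (norm (K x - y) + norm (K x0 - y))"
    by (simp add: mult_left_mono)
  then show ?thesis
    using le fin by (cases "\<psi> x"; cases "\<psi> x0") (auto simp: bregman_distance_def)
qed

theorem theorem3p4:
  fixes K :: "'a::banach \<Rightarrow>\<^sub>L 'b::{real_inner, complete_space}"
    and Qad :: "'a set"
    and \<psi>1 \<psi>2 :: "'a \<Rightarrow> ereal"
    and xdag :: 'a
    and cm :: real
  assumes "convex Qad"
    and "\<And>x. 0 \<le> \<psi>1 x" and "convex_functional \<psi>1" and "lower_semicontinuous \<psi>1"
    and "\<And>x. 0 \<le> \<psi>2 x" and "convex_functional \<psi>2" and "lower_semicontinuous \<psi>2"
    and "xdag \<in> Qad" and "\<psi>1 xdag < \<infinity>" and "\<psi>2 xdag < \<infinity>"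
    and source_condition:
      "range (banach_adjoint K) \<inter> subdifferential \<psi>1 xdag \<inter> subdifferential \<psi>2 xdag \<noteq> {}"
    and "1 \<le> cm"
  shows "\<exists>C::real. \<forall>\<delta> ydelta \<eta>1 \<eta>2 x.
    0 < \<delta> \<longrightarrow> fidelity K xdag ydelta = \<delta>\<^sup>2 \<longrightarrow> 0 < \<eta>1 \<longrightarrow> 0 < \<eta>2 \<longrightarrow>
    minimizer_over Qad (tikhonov_functional K \<psi>1 \<psi>2 (\<eta>1, \<eta>2) ydelta) x \<longrightarrow>
    fidelity K x ydelta = cm * \<delta>\<^sup>2 \<longrightarrow>
    (\<exists>\<psi>\<in>{\<psi>1, \<psi>2}. \<exists>\<xi>\<in>subdifferential \<psi> xdag.
       bregman_distance \<psi> \<xi> x xdag \<le> ereal (C * \<delta>))"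
proof -
  obtain w where w: "banach_adjoint K w \<in> subdifferential \<psi>1 xdag"
      "banach_adjoint K w \<in> subdifferential \<psi>2 xdag"
    using source_condition by blast
  have fin: "\<bar>\<psi>1 xdag\<bar> \<noteq> \<infinity>" "\<bar>\<psi>2 xdag\<bar> \<noteq> \<infinity>"
    using assms(2)[of xdag] assms(5)[of xdag] \<open>\<psi>1 xdag < \<infinity>\<close> \<open>\<psi>2 xdag < \<infinity>\<close> by auto
  show ?thesis
  proof (intro exI[of _ "norm w * (sqrt cm + 1)"] allI impI)
    fix \<delta> \<eta>1 \<eta>2 :: real and y :: 'b and x :: 'a
    assume \<delta>: "0 < \<delta>" and exact: "fidelity K xdag y = \<delta>\<^sup>2" and \<eta>: "0 < \<eta>1" "0 < \<eta>2"
      and min: "minimizer_over Qad (tikhonov_functional K \<psi>1 \<psi>2 (\<eta>1, \<eta>2) y) x"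
      and discrepancy: "fidelity K x y = cm * \<delta>\<^sup>2"
    have "fidelity K xdag y \<le> fidelity K x y"
      using exact discrepancy mult_right_mono[OF \<open>1 \<le> cm\<close>, of "\<delta>\<^sup>2"] by simp
    then have "\<psi>1 x \<le> \<psi>1 xdag \<or> \<psi>2 x \<le> \<psi>2 xdag"
      using penalty_decreases_at_minimizer[OF min \<open>xdag \<in> Qad\<close>] \<eta> fin by blast
    then obtain \<psi> where \<psi>: "\<psi> \<in> {\<psi>1, \<psi>2}" "\<psi> x \<le> \<psi> xdag"
      by blast
    then have sub: "banach_adjoint K w \<in> subdifferential \<psi> xdag" and "\<bar>\<psi> xdag\<bar> \<noteq> \<infinity>"
      using w fin by auto
    have "norm (K xdag - y) = \<delta>"
      using exact \<delta> by (simp add: fidelity_def)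
    moreover have "norm (K x - y) = sqrt cm * \<delta>"
      using arg_cong[OF discrepancy, of sqrt] \<delta> by (simp add: fidelity_def real_sqrt_mult)
    ultimately have "bregman_distance \<psi> (banach_adjoint K w) x xdag
        \<le> ereal (norm w * (sqrt cm + 1) * \<delta>)"
      using bregman_distance_le_residuals[of \<psi> x xdag K w y] \<psi>(2) \<open>\<bar>\<psi> xdag\<bar> \<noteq> \<infinity>\<close>
      by (simp add: algebra_simps)
    then show "\<exists>\<psi>\<in>{\<psi>1, \<psi>2}. \<exists>\<xi>\<in>subdifferential \<psi> xdag.
        bregman_distance \<psi> \<xi> x xdag \<le> ereal (norm w * (sqrt cm + 1) * \<delta>)"
      using \<psi>(1) sub by blast
  qed
qed

end
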